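(* Let the group $G=AB$ be the product of two locally cyclic subgroups $A$ and $B$ such that $A$ is periodic and $B$ is non-trivial torsion-free. Then one of the following statements holds: 1) the subgroup $A$ is normal in $G$ and so $G=A\rtimes B$; 2) $A=A_1\langle a\rangle$ for a subgroup $A_1\le A$ and an element $a\in A$ with $a^2\in A_1$, the subgroup $A_1$ is normal in $G$, and $G=(A_1\rtimes B)\langle a\rangle$ with $b^a=b^{-1}\phi(b)$ for all $b\in B$, where $\phi:B\to A_1$ is a derivation of $B$ into $A_1$.
   Context: $G=AB$ means $G=\{ab\mid a\in A,\ b\in B\}$. A group is locally cyclic if each of its finitely generated subgroups is cyclic. Conjugation is written $x^g=g^{-1}xg$. $X\rtimes Y$ denotes the internal semidirect product with $X$ normal. When $A_1$ is an abelian subgroup normalized by $B$, a mapping $\phi:B\to A_1$ is a derivation of $B$ into $A_1$ if $\phi(bc)=\phi(b)\phi(c)^b$ for all $b,c\in B$. *)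

theory Defs
  imports "HOL-Algebra.Algebra"
begin

definition locally_cyclic :: "('a, 'b) monoid_scheme \<Rightarrow> bool" where
  "locally_cyclic G \<longleftrightarrow>
    (\<forall>S. finite S \<and> S \<subseteq> carrier G \<longrightarrow> cyclic_group (subgroup_generated G S))"

definition periodic :: "('a, 'b) monoid_scheme \<Rightarrow> bool" where
  "periodic G \<longleftrightarrow> (\<forall>x\<in>carrier G. \<exists>n::nat. n > 0 \<and> x [^]\<^bsub>G\<^esub> n = \<one>\<^bsub>G\<^esub>)"

definition torsion_free :: "('a, 'b) monoid_scheme \<Rightarrow> bool" where
  "torsion_free G \<longleftrightarrow>
    (\<forall>x\<in>carrier G. \<forall>n::nat. n > 0 \<and> x [^]\<^bsub>G\<^esub> n = \<one>\<^bsub>G\<^esub> \<longrightarrow> x = \<one>\<^bsub>G\<^esub>)"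

text \<open>\<open>conj_by G x g\<close> is written $x^g$ on paper.\<close>

definition conj_by :: "('a, 'b) monoid_scheme \<Rightarrow> 'a \<Rightarrow> 'a \<Rightarrow> 'a" where
  "conj_by G x g = inv\<^bsub>G\<^esub> g \<otimes>\<^bsub>G\<^esub> x \<otimes>\<^bsub>G\<^esub> g"

text \<open>\<open>is_semidirect G K N H\<close>: the subgroup \<open>K\<close> of \<open>G\<close> is the internal semidirect product
  of \<open>N\<close> and \<open>H\<close>, where only \<open>N\<close> needs to be normal, and only in \<open>K\<close>.\<close>

definition is_semidirect :: "('a, 'b) monoid_scheme \<Rightarrow> 'a set \<Rightarrow> 'a set \<Rightarrow> 'a set \<Rightarrow> bool" where
  "is_semidirect G K N H \<longleftrightarrow>
    subgroup K G \<and> N \<lhd> (G\<lparr>carrier := K\<rparr>) \<and> subgroup H G \<and>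
    K = N <#>\<^bsub>G\<^esub> H \<and> N \<inter> H = {\<one>\<^bsub>G\<^esub>}"

text \<open>Meant for subgroups \<open>B\<close> and \<open>A1\<close> of \<open>G\<close> with \<open>A1\<close> abelian and normalized by \<open>B\<close>;
  these conditions are not part of the definition.\<close>

definition derivation ::
    "('a, 'b) monoid_scheme \<Rightarrow> 'a set \<Rightarrow> 'a set \<Rightarrow> ('a \<Rightarrow> 'a) \<Rightarrow> bool" where
  "derivation G B A1 \<phi> \<longleftrightarrow>
    \<phi> \<in> B \<rightarrow> A1 \<and> (\<forall>b\<in>B. \<forall>c\<in>B. \<phi> (b \<otimes>\<^bsub>G\<^esub> c) = \<phi> b \<otimes>\<^bsub>G\<^esub> conj_by G (\<phi> c) b)"

end

theory Submission
  imports Defs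
begin

text \<open>
  The core \<open>K\<close> of \<open>A\<close> in \<open>G\<close> is the largest normal subgroup of \<open>G\<close> inside \<open>A\<close>; passing to \<open>G/K\<close>
  one may assume \<open>K = 1\<close>. By Ito's argument the subgroup \<open>N = [A,B]\<close> is abelian and normal. An element
  of finite order in \<open>N\<close> lies in \<open>A\<close>, so \<open>N\<close> is torsion-free, and then an element of \<open>A\<close> centralizing
  \<open>N\<close> is central and hence trivial.

  For \<open>n \<in> N\<close> choose \<open>a, a' \<in> A\<close> with \<open>a n \<in> B\<close> and \<open>a' n\<^sup>2 \<in> B\<close>. As these two elements commute,
  \<open>n\<^sup>2\<close> conjugated by \<open>a\<close> is the product of \<open>n\<close> and its conjugate by \<open>a'\<close>. The orbit of \<open>n\<close> under
  \<open>\<langle>a,a'\<rangle>\<close> is a finite set in a torsion-free abelian group, so it has an extreme point, and the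
  midpoint relation there forces \<open>a\<close> to commute with \<open>n\<close>. Hence a power of \<open>n\<close> lies in \<open>B\<close>, so \<open>B\<close>
  centralizes \<open>N\<close>, so \<open>a\<close> does as well, thus \<open>a = 1\<close> and \<open>N \<subseteq> B\<close>. Therefore \<open>A\<close> acts on the rank-one
  group \<open>B\<close>, and automorphisms of finite order of such a group are \<open>\<plusminus>1\<close>. Back in \<open>G\<close>, either \<open>A = K\<close>, or
  \<open>K\<close> has index two in \<open>A\<close> and \<open>A1 = K\<close>.
\<close>

section \<open>Conjugation\<close>

context group begin

lemma inv_mult_cancel_left [simp]:
  "\<lbrakk>x \<in> carrier G; y \<in> carrier G\<rbrakk> \<Longrightarrow> inv x \<otimes> (x \<otimes> y) = y"
  by (simp flip: m_assoc)

lemma mult_inv_cancel_left [simp]: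
  "\<lbrakk>x \<in> carrier G; y \<in> carrier G\<rbrakk> \<Longrightarrow> x \<otimes> (inv x \<otimes> y) = y"
  by (simp flip: m_assoc)

lemma conj_by_closed [simp]:
  "\<lbrakk>x \<in> carrier G; g \<in> carrier G\<rbrakk> \<Longrightarrow> conj_by G x g \<in> carrier G"
  by (simp add: conj_by_def)

lemma conj_by_mult:
  "\<lbrakk>x \<in> carrier G; y \<in> carrier G; g \<in> carrier G\<rbrakk>
    \<Longrightarrow> conj_by G (x \<otimes> y) g = conj_by G x g \<otimes> conj_by G y g"
  by (simp add: conj_by_def m_assoc)

lemma conj_by_one [simp]: "g \<in> carrier G \<Longrightarrow> conj_by G \<one> g = \<one>"
  by (simp add: conj_by_def)

lemma conj_by_by_one [simp]: "x \<in> carrier G \<Longrightarrow> conj_by G x \<one> = x"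
  by (simp add: conj_by_def)

lemma conj_by_inv:
  "\<lbrakk>x \<in> carrier G; g \<in> carrier G\<rbrakk> \<Longrightarrow> conj_by G (inv x) g = inv (conj_by G x g)"
  by (simp add: conj_by_def inv_mult_group m_assoc)

lemma conj_by_conj_by:
  "\<lbrakk>x \<in> carrier G; g \<in> carrier G; h \<in> carrier G\<rbrakk>
    \<Longrightarrow> conj_by G (conj_by G x g) h = conj_by G x (g \<otimes> h)"
  by (simp add: conj_by_def inv_mult_group m_assoc)

lemma conj_by_pow:
  "\<lbrakk>x \<in> carrier G; g \<in> carrier G\<rbrakk> \<Longrightarrow> conj_by G (x [^] (n::nat)) g = conj_by G x g [^] n"
  by (induction n) (simp_all add: conj_by_mult)

lemma conj_by_int_pow:
  "\<lbrakk>x \<in> carrier G; g \<in> carrier G\<rbrakk> \<Longrightarrow> conj_by G (x [^] (n::int)) g = conj_by G x g [^] n"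
  by (simp add: int_pow_def2 conj_by_pow conj_by_inv del: pow_nat)

lemma conj_by_eq_iff:
  assumes "x \<in> carrier G" "y \<in> carrier G" "g \<in> carrier G"
  shows "conj_by G x g = y \<longleftrightarrow> x \<otimes> g = g \<otimes> y"
proof
  assume "conj_by G x g = y"
  with assms show "x \<otimes> g = g \<otimes> y" by (auto simp: conj_by_def m_assoc)
next
  assume "x \<otimes> g = g \<otimes> y"
  with assms show "conj_by G x g = y" by (simp add: conj_by_def m_assoc)
qed

lemma normal_conj_by_iff:
  "N \<lhd> G \<longleftrightarrow> subgroup N G \<and> (\<forall>g\<in>carrier G. \<forall>x\<in>N. conj_by G x g \<in> N)"
proof (intro iffI conjI ballI)
  fix g x assume "N \<lhd> G" "g \<in> carrier G" "x \<in> N"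
  then show "conj_by G x g \<in> N"
    by (simp add: conj_by_def normal.inv_op_closed1)
next
  assume *: "subgroup N G \<and> (\<forall>g\<in>carrier G. \<forall>x\<in>N. conj_by G x g \<in> N)"
  show "N \<lhd> G"
  proof (rule normal_invI)
    fix x h assume "x \<in> carrier G" "h \<in> N"
    with * have "conj_by G h (inv x) \<in> N" by blast
    with \<open>x \<in> carrier G\<close> show "x \<otimes> h \<otimes> inv x \<in> N" by (simp add: conj_by_def)
  qed (use * in blast)
qed (simp add: normal_imp_subgroup)

text \<open>Modulo the normal subgroup \<open>T\<close> the factor \<open>t\<close> disappears;
  collecting the powers of \<open>a\<close> on the left only conjugates elements of \<open>T\<close>
  within \<open>T\<close>.\<close>

lemma mult_pow_normal:
  assumes "T \<lhd> G" "a \<in> carrier G" "t \<in> T"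
  shows "\<exists>s\<in>T. (a \<otimes> t) [^] (k::nat) = a [^] k \<otimes> s"
proof (induction k)
  case 0
  then show ?case using subgroup.one_closed[OF normal_imp_subgroup[OF assms(1)]] by force
next
  case (Suc k)
  have T: "subgroup T G" using assms(1) by (rule normal_imp_subgroup)
  have tG: "t \<in> carrier G" using T assms(3) by (rule subgroup.mem_carrier)
  from Suc obtain s where s: "s \<in> T" "(a \<otimes> t) [^] k = a [^] k \<otimes> s" by blast
  have sG: "s \<in> carrier G" using T s(1) by (rule subgroup.mem_carrier)
  have "(a \<otimes> t) [^] Suc k = a [^] Suc k \<otimes> (conj_by G s a \<otimes> t)"
    using s(2) sG tG assms(2) by (simp add: conj_by_def m_assoc)
  moreover have "conj_by G s a \<otimes> t \<in> T"
    using assms s(1) T by (meson normal_conj_by_iff subgroup.m_closed)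
  ultimately show ?case by blast
qed

text \<open>Whatever commutes with all of \<open>S\<close> commutes with all of
  \<open>generate G S\<close>, because centralizers are subgroups. This is applied twice: to each
  generator against \<open>x\<close>, then to \<open>x\<close> against \<open>y\<close>.\<close>

lemma generate_commute:
  assumes S: "S \<subseteq> carrier G" and comm: "\<And>x y. x \<in> S \<Longrightarrow> y \<in> S \<Longrightarrow> x \<otimes> y = y \<otimes> x"
    and "x \<in> generate G S" "y \<in> generate G S"
  shows "x \<otimes> y = y \<otimes> x"
proof -
  have gen: "z \<in> carrier G \<and> x \<otimes> z = z \<otimes> x"
    if "z \<in> generate G S" "x \<in> carrier G" "\<And>s. s \<in> S \<Longrightarrow> x \<otimes> s = s \<otimes> x" for x z
    using that(1)
  proof (induction z rule: generate.induct)
    case (inv h)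
    then have h: "h \<in> carrier G" using S by blast
    then have "conj_by G x h = x" using that(2,3) inv by (simp add: conj_by_eq_iff)
    then have "conj_by G x (inv h) = x"
      using h that(2) conj_by_conj_by[of x h "inv h"] by simp
    then show ?case using h that(2) by (simp add: conj_by_eq_iff)
  next
    case (eng h1 h2)
    then show ?case using that(2) by (metis m_assoc m_closed)
  qed (use S that in auto)
  have "x \<otimes> s = s \<otimes> x" if "s \<in> S" for s
    using gen[OF assms(3), of s] comm that S by auto
  moreover have "x \<in> carrier G" using S assms(3) generate_in_carrier by blast
  ultimately show ?thesis using gen[OF assms(4)] by blast
qed

end

section \<open>Extreme points in torsion-free abelian groups\<close>

text \<open>In an abelian group this is the cone of elements above the identity for a
  translation-invariant partial order; the last clause is antisymmetry.\<close>

definition strict_cone :: "('a, 'b) monoid_scheme \<Rightarrow> 'a set \<Rightarrow> bool" where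
  "strict_cone G P \<longleftrightarrow> P \<subseteq> carrier G \<and> \<one>\<^bsub>G\<^esub> \<in> P \<and> (\<forall>p\<in>P. \<forall>q\<in>P. p \<otimes>\<^bsub>G\<^esub> q \<in> P) \<and>
    (\<forall>p\<in>P. inv\<^bsub>G\<^esub> p \<in> P \<longrightarrow> p = \<one>\<^bsub>G\<^esub>)"

context comm_group begin

text \<open>The new cone consists of the products of elements of \<open>P\<close> with natural
  powers of \<open>x\<close>. If such a product and its inverse both occur, the inverse of some
  \<open>x [^] (i + j)\<close> lies in \<open>P\<close>, so by \<open>free\<close> both exponents
  vanish and antisymmetry of \<open>P\<close> applies.\<close>

lemma strict_cone_extend:
  assumes P: "strict_cone G P" and x: "x \<in> carrier G"
    and free: "\<And>j::nat. j > 0 \<Longrightarrow> inv (x [^] j) \<notin> P"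
  shows "\<exists>P'. strict_cone G P' \<and> P \<subseteq> P' \<and> x \<in> P'"
proof (intro exI conjI)
  let ?P' = "{p \<otimes> x [^] (i::nat) |p i. p \<in> P}"
  have PG: "p \<in> carrier G" if "p \<in> P" for p using P that by (auto simp: strict_cone_def)
  have P1: "\<one> \<in> P" using P by (simp add: strict_cone_def)
  have Pm: "p \<otimes> q \<in> P" if "p \<in> P" "q \<in> P" for p q using P that by (simp add: strict_cone_def)
  have Pi: "p = \<one>" if "p \<in> P" "inv p \<in> P" for p using P that by (simp add: strict_cone_def)
  show "P \<subseteq> ?P'"
  proof
    fix p assume "p \<in> P"
    then have "p = p \<otimes> x [^] (0::nat)" using PG by simp
    then show "p \<in> ?P'" using \<open>p \<in> P\<close> by blast
  qed
  have "x = \<one> \<otimes> x [^] (1::nat)" using x by simp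
  then show "x \<in> ?P'" using P1 by blast
  show "strict_cone G ?P'"
    unfolding strict_cone_def
  proof (intro conjI ballI impI)
    show "?P' \<subseteq> carrier G" using PG x by auto
    show "\<one> \<in> ?P'" using P1 \<open>P \<subseteq> ?P'\<close> by blast
  next
    fix u v assume "u \<in> ?P'" "v \<in> ?P'"
    then obtain p i q j where u: "p \<in> P" "u = p \<otimes> x [^] (i::nat)"
      and v: "q \<in> P" "v = q \<otimes> x [^] (j::nat)" by blast
    have "u \<otimes> v = (p \<otimes> q) \<otimes> (x [^] i \<otimes> x [^] j)"
      using u v PG x by (simp add: m_ac)
    also have "\<dots> = (p \<otimes> q) \<otimes> x [^] (i + j)" using x by (simp add: nat_pow_mult)
    finally show "u \<otimes> v \<in> ?P'" using Pm u v by blast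
  next
    fix u assume "u \<in> ?P'" "inv u \<in> ?P'"
    then obtain p i q j where u: "p \<in> P" "u = p \<otimes> x [^] (i::nat)"
      and v: "q \<in> P" "inv u = q \<otimes> x [^] (j::nat)" by blast
    have G: "p \<in> carrier G" "q \<in> carrier G" "u \<in> carrier G" using u v PG x by auto
    have "(p \<otimes> q) \<otimes> x [^] (i + j) = (p \<otimes> q) \<otimes> (x [^] i \<otimes> x [^] j)"
      using x by (simp add: nat_pow_mult)
    also have "\<dots> = (p \<otimes> x [^] i) \<otimes> (q \<otimes> x [^] j)"
      using G x by (simp add: m_ac)
    also have "\<dots> = u \<otimes> inv u" by (simp only: u(2)[symmetric] v(2)[symmetric])
    finally have eq: "(p \<otimes> q) \<otimes> x [^] (i + j) = \<one>" using G by simp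
    then have "inv (x [^] (i + j)) = p \<otimes> q" using G x by (simp add: inv_equality)
    then have "inv (x [^] (i + j)) \<in> P" using Pm u v by simp
    then have ij: "i = 0" "j = 0" using free[of "i + j"] by (cases "i + j > 0"; simp)+
    have "inv p \<in> P" using u v ij G by (metis nat_pow_0 r_one)
    then show "u = \<one>" using Pi u ij G by (metis nat_pow_0 r_one)
  qed
qed

text \<open>The order is extended one element at a time. If neither \<open>x\<close> nor
  \<open>inv x\<close> could be adjoined, a negative and a positive power of \<open>x\<close> would
  both lie in \<open>P\<close>; raising them to a common exponent would make \<open>x\<close> a
  torsion element.\<close>

lemma exists_strict_cone_deciding:
  assumes tf: "torsion_free G" and "finite S" "S \<subseteq> carrier G"
  shows "\<exists>P. strict_cone G P \<and> (\<forall>x\<in>S. x \<in> P \<or> inv x \<in> P)"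
  using assms(2,3)
proof (induction S rule: finite_induct)
  case empty
  have "strict_cone G {\<one>}" by (simp add: strict_cone_def)
  then show ?case by blast
next
  case (insert x S)
  then obtain P where P: "strict_cone G P" "\<forall>x\<in>S. x \<in> P \<or> inv x \<in> P" by blast
  have x: "x \<in> carrier G" using insert by simp
  have P1: "\<one> \<in> P" using P(1) by (simp add: strict_cone_def)
  have Pm: "p \<otimes> q \<in> P" if "p \<in> P" "q \<in> P" for p q using P(1) that by (simp add: strict_cone_def)
  have Pi: "p = \<one>" if "p \<in> P" "inv p \<in> P" for p using P(1) that by (simp add: strict_cone_def)
  have Pp: "p [^] (n::nat) \<in> P" if "p \<in> P" for p n
    using that by (induction n) (simp_all add: P1 Pm)
  show ?case
  \<comment> \<open>The conjunct \<open>x \<noteq> \<one>\<close> sends the identity, which lies in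
    every cone, to the case where \<open>x\<close> itself is adjoined.\<close>
  proof (cases "\<exists>j>0::nat. inv (x [^] j) \<in> P \<and> x \<noteq> \<one>")
    case False
    have "\<exists>P'. strict_cone G P' \<and> P \<subseteq> P' \<and> x \<in> P'"
    proof (cases "x = \<one>")
      case True
      then show ?thesis using P P1 by blast
    next
      case xne: False
      show ?thesis by (rule strict_cone_extend[OF P(1) x]) (use False xne in blast)
    qed
    then show ?thesis using P(2) by blast
  next
    case True
    then obtain j where j: "j > 0" "inv (x [^] (j::nat)) \<in> P" and ne: "x \<noteq> \<one>" by blast
    have "inv (inv x [^] i) \<notin> P" if "i > 0" for i :: nat
    proof
      assume "inv (inv x [^] i) \<in> P"
      then have "x [^] i \<in> P" using x by (simp add: nat_pow_inv)
      then have "(x [^] i) [^] j \<in> P" by (rule Pp)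
      then have 1: "x [^] (i * j) \<in> P" using x by (simp add: nat_pow_pow)
      have "(inv (x [^] j)) [^] i \<in> P" using j(2) by (rule Pp)
      then have "inv (x [^] (i * j)) \<in> P"
        using x by (simp add: nat_pow_pow mult.commute flip: nat_pow_inv)
      with 1 have "x [^] (i * j) = \<one>" by (rule Pi)
      with tf x ne that j(1) show False unfolding torsion_free_def by (metis nat_0_less_mult_iff)
    qed
    with strict_cone_extend[OF P(1), of "inv x"] x
    obtain P' where "strict_cone G P'" "P \<subseteq> P'" "inv x \<in> P'" by auto
    then show ?thesis using P(2) by blast
  qed
qed

text \<open>Take \<open>e\<close> maximal for an order that compares any two elements of
  \<open>S\<close>. If \<open>y\<close> and \<open>z\<close> have midpoint \<open>e\<close>, their
  quotients by \<open>e\<close> are mutually inverse, so one of them lies in the cone. Maximality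
  makes the corresponding point equal to \<open>e\<close>, and then the other one as well.\<close>

lemma exists_extreme_point:
  assumes tf: "torsion_free G" and S: "finite S" "S \<subseteq> carrier G" "S \<noteq> {}"
  shows "\<exists>e\<in>S. \<forall>y\<in>S. \<forall>z\<in>S. y \<otimes> z = e \<otimes> e \<longrightarrow> y = e"
proof -
  \<comment> \<open>Deciding all quotients of elements of \<open>S\<close> makes the order total on
    \<open>S\<close>.\<close>
  let ?Y = "(\<lambda>(x, y). x \<otimes> inv y) ` (S \<times> S)"
  have "finite ?Y" "?Y \<subseteq> carrier G" using S by auto
  then obtain P where P: "strict_cone G P" "\<forall>x\<in>?Y. x \<in> P \<or> inv x \<in> P"
    using exists_strict_cone_deciding[OF tf] by blast
  have Pm: "p \<otimes> q \<in> P" if "p \<in> P" "q \<in> P" for p q using P(1) that by (simp add: strict_cone_def)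
  have Pi: "p = \<one>" if "p \<in> P" "inv p \<in> P" for p using P(1) that by (simp add: strict_cone_def)
  define less where "less x y \<longleftrightarrow> y \<otimes> inv x \<in> P \<and> x \<noteq> y" for x y
  have asym: "x = y" if "x \<in> S" "y \<in> S" "y \<otimes> inv x \<in> P" "x \<otimes> inv y \<in> P" for x y
  proof -
    have c: "x \<in> carrier G" "y \<in> carrier G" using that S by auto
    have "inv (y \<otimes> inv x) = x \<otimes> inv y" using c by (simp add: inv_mult_group)
    with that have "y \<otimes> inv x = \<one>" by (intro Pi) simp_all
    then show ?thesis using c by (simp add: inv_solve_right')
  qed
  have tr: "z \<otimes> inv x \<in> P" if "x \<in> S" "y \<in> S" "z \<in> S" "y \<otimes> inv x \<in> P" "z \<otimes> inv y \<in> P" for x y z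
  proof -
    have c: "x \<in> carrier G" "y \<in> carrier G" "z \<in> carrier G" using that S by auto
    have "(z \<otimes> inv y) \<otimes> (y \<otimes> inv x) = z \<otimes> inv x" using c by (simp add: m_assoc)
    then show ?thesis using Pm[OF that(5,4)] by simp
  qed
  have "asymp_on S less" by (rule asymp_onI) (auto simp: less_def dest: asym)
  moreover have "transp_on S less"
    by (rule transp_onI) (unfold less_def, use tr asym in blast)
  ultimately obtain e where e: "e \<in> S" "\<And>x. x \<in> S \<Longrightarrow> x \<noteq> e \<Longrightarrow> \<not> less e x"
    using Finite_Set.bex_max_element[OF S(1) _ _ S(3), of less] by blast
  have max: "x = e" if "x \<in> S" "x \<otimes> inv e \<in> P" for x
    using e(2)[of x] that by (auto simp: less_def)
  show ?thesis
  proof (intro bexI[OF _ e(1)] ballI impI)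
    fix y z assume yz: "y \<in> S" "z \<in> S" "y \<otimes> z = e \<otimes> e"
    have c: "y \<in> carrier G" "z \<in> carrier G" "e \<in> carrier G" using yz S e(1) by auto
    have "y \<otimes> inv e \<in> P \<or> inv (y \<otimes> inv e) \<in> P" using P(2) yz(1) e(1) by auto
    moreover have "inv (y \<otimes> inv e) = z \<otimes> inv e"
    proof (rule inv_equality)
      have "z \<otimes> inv e \<otimes> (y \<otimes> inv e) = (y \<otimes> z) \<otimes> (inv e \<otimes> inv e)"
        using c by (simp add: m_ac)
      also have "\<dots> = \<one>" using c by (simp add: yz(3) m_assoc)
      finally show "z \<otimes> inv e \<otimes> (y \<otimes> inv e) = \<one>" .
    qed (use c in simp_all)
    ultimately have "y = e \<or> z = e" using max yz by auto
    then show "y = e"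
    proof
      assume "z = e"
      then show ?thesis using yz(3) c by simp
    qed
  qed
qed

end

section \<open>Products of two abelian groups\<close>

locale abelian_factorization = group G for G (structure) +
  fixes A B
  assumes A: "subgroup A G" and B: "subgroup B G"
    and factor: "\<And>g. g \<in> carrier G \<Longrightarrow> \<exists>a\<in>A. \<exists>b\<in>B. g = a \<otimes> b"
    and A_comm: "\<And>x y. x \<in> A \<Longrightarrow> y \<in> A \<Longrightarrow> x \<otimes> y = y \<otimes> x"
    and B_comm: "\<And>x y. x \<in> B \<Longrightarrow> y \<in> B \<Longrightarrow> x \<otimes> y = y \<otimes> x"
begin

lemma A_carrier [simp]: "a \<in> A \<Longrightarrow> a \<in> carrier G"
  using A by (rule subgroup.mem_carrier)

lemma B_carrier [simp]: "b \<in> B \<Longrightarrow> b \<in> carrier G"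
  using B by (rule subgroup.mem_carrier)

text \<open>Inverting every element turns G = AB into G = BA.\<close>

lemma factor': "g \<in> carrier G \<Longrightarrow> \<exists>b\<in>B. \<exists>a\<in>A. g = b \<otimes> a"
proof -
  assume g: "g \<in> carrier G"
  then obtain a b where "a \<in> A" "b \<in> B" "inv g = a \<otimes> b" using factor[of "inv g"] by auto
  then have "g = inv b \<otimes> inv a" using g by (metis A_carrier B_carrier inv_inv inv_mult_group)
  moreover have "inv a \<in> A" "inv b \<in> B"
    using A B \<open>a \<in> A\<close> \<open>b \<in> B\<close> by (simp_all add: subgroup.m_inv_closed)
  ultimately show ?thesis by blast
qed

section \<open>Commutators of \<open>A\<close> with \<open>B\<close> and their conjugates\<close>

definition commutator where "commutator x y = inv x \<otimes> inv y \<otimes> x \<otimes> y"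

definition AB_commutators where "AB_commutators = {commutator a b |a b. a \<in> A \<and> b \<in> B}"

lemma commutator_closed [simp]:
  "x \<in> carrier G \<Longrightarrow> y \<in> carrier G \<Longrightarrow> commutator x y \<in> carrier G"
  by (simp add: commutator_def)

text \<open>Conjugation by \<open>a1\<close> fixes \<open>a\<close> and turns \<open>b\<close> into
  \<open>inv a1 \<otimes> a2 \<otimes> b2\<close>. The left factor from \<open>A\<close> commutes
  with \<open>a\<close> and so cancels inside the commutator.\<close>

lemma conj_commutator_A:
  assumes [simp]: "a \<in> A" "b \<in> B" "a1 \<in> A" "a2 \<in> A" "b2 \<in> B" and eq: "b \<otimes> a1 = a2 \<otimes> b2"
  shows "conj_by G (commutator a b) a1 = commutator a b2"
proof -
  have b: "b = a2 \<otimes> b2 \<otimes> inv a1" using eq by (metis A_carrier B_carrier assms(1-5) inv_solve_right' m_closed)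
  have 1: "a \<otimes> (a2 \<otimes> x) = a2 \<otimes> (a \<otimes> x)" if "x \<in> carrier G" for x
    using A_comm[of a a2] that by (simp flip: m_assoc)
  have 2: "inv a1 \<otimes> (inv a \<otimes> x) = inv a \<otimes> (inv a1 \<otimes> x)" if "x \<in> carrier G" for x
    using A_comm[of "inv a" "inv a1"] that A by (simp add: subgroup.m_inv_closed flip: m_assoc)
  show ?thesis
    unfolding b commutator_def conj_by_def by (simp add: m_assoc inv_mult_group 1 2)
qed

text \<open>The mirror image of \<open>conj_commutator_A\<close>: now \<open>b\<close> is fixed, and
  the factor from \<open>B\<close> in the conjugate of \<open>a\<close> cancels.\<close>

lemma conj_commutator_B:
  assumes [simp]: "a \<in> A" "b \<in> B" "b1 \<in> B" "b3 \<in> B" "a3 \<in> A" and eq: "a \<otimes> b1 = b3 \<otimes> a3"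
  shows "conj_by G (commutator a b) b1 = commutator a3 b"
proof -
  have a: "a = b3 \<otimes> a3 \<otimes> inv b1" using eq by (metis A_carrier B_carrier assms(1-5) inv_solve_right' m_closed)
  have 1: "inv b \<otimes> (b3 \<otimes> x) = b3 \<otimes> (inv b \<otimes> x)" if "x \<in> carrier G" for x
    using B_comm[of "inv b" b3] that B by (simp add: subgroup.m_inv_closed flip: m_assoc)
  have 2: "b \<otimes> b1 = b1 \<otimes> b" by (simp add: B_comm)
  show ?thesis
    unfolding a commutator_def conj_by_def by (simp add: m_assoc inv_mult_group 1 2)
qed

text \<open>Conjugation by \<open>A\<close> changes only the second entry of a commutator and
  conjugation by \<open>B\<close> only the first. Hence the set of commutators itself is invariant,
  not merely the subgroup it generates.\<close>

lemma AB_commutators_conj: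
  assumes "c \<in> AB_commutators" "g \<in> carrier G"
  shows "conj_by G c g \<in> AB_commutators"
proof -
  obtain a b where c: "a \<in> A" "b \<in> B" "c = commutator a b"
    using assms(1) by (auto simp: AB_commutators_def)
  obtain a1 b1 where g: "a1 \<in> A" "b1 \<in> B" "g = a1 \<otimes> b1" using factor assms(2) by blast
  obtain a2 b2 where 2: "a2 \<in> A" "b2 \<in> B" "b \<otimes> a1 = a2 \<otimes> b2" using factor[of "b \<otimes> a1"] c g by auto
  obtain a3 b3 where 3: "a3 \<in> A" "b3 \<in> B" "a \<otimes> b1 = b3 \<otimes> a3" using factor'[of "a \<otimes> b1"] c g by auto
  have "conj_by G c g = conj_by G (conj_by G c a1) b1"
    using c g by (simp add: conj_by_conj_by)
  also have "\<dots> = commutator a3 b2"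
    using c g 2 3 by (simp add: conj_commutator_A conj_commutator_B)
  finally show ?thesis using 2 3 by (auto simp: AB_commutators_def)
qed

text \<open>Ito's argument: conjugation by \<open>a1 \<otimes> b1\<close> and by \<open>b1 \<otimes> a1\<close> agree on the commutators.\<close>

lemma AB_commutators_commute:
  assumes c: "c \<in> AB_commutators" and "d \<in> AB_commutators"
  shows "c \<otimes> d = d \<otimes> c"
proof -
  obtain a1 b1 where d: "a1 \<in> A" "b1 \<in> B" "d = commutator a1 b1"
    using assms(2) by (auto simp: AB_commutators_def)
  have cG: "c \<in> carrier G" using c by (auto simp: AB_commutators_def)
  \<comment> \<open>Conjugating \<open>c'\<close> by \<open>b1 \<otimes> a1\<close> gives back
    \<open>c\<close>; conjugating it by \<open>a1 \<otimes> b1 = b1 \<otimes> a1 \<otimes> d\<close>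
    gives \<open>c\<close> conjugated by \<open>d\<close>. Equality of the two results is the
    claim.\<close>
  define c' where "c' = conj_by G c (inv (b1 \<otimes> a1))"
  have "c' \<in> AB_commutators" unfolding c'_def using c d by (intro AB_commutators_conj) auto
  then obtain a b where c': "a \<in> A" "b \<in> B" "c' = commutator a b"
    by (auto simp: AB_commutators_def)
  obtain a2 b2 where 2: "a2 \<in> A" "b2 \<in> B" "b \<otimes> a1 = a2 \<otimes> b2" using factor[of "b \<otimes> a1"] c' d by auto
  obtain a3 b3 where 3: "a3 \<in> A" "b3 \<in> B" "a \<otimes> b1 = b3 \<otimes> a3" using factor'[of "a \<otimes> b1"] c' d by auto
  have "conj_by G c' (b1 \<otimes> a1) = conj_by G c' (a1 \<otimes> b1)"
    using c' d 2 3 by (simp add: conj_commutator_A conj_commutator_B flip: conj_by_conj_by)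
  also have "a1 \<otimes> b1 = b1 \<otimes> a1 \<otimes> d" using d by (simp add: commutator_def m_assoc inv_mult_group)
  also have "conj_by G c' (b1 \<otimes> a1 \<otimes> d) = conj_by G (conj_by G c' (b1 \<otimes> a1)) d"
    using c' d by (simp add: conj_by_conj_by)
  also have "conj_by G c' (b1 \<otimes> a1) = c"
    using cG d by (simp add: c'_def conj_by_conj_by)
  finally have "conj_by G c d = c" by (rule sym)
  then show ?thesis using cG d by (simp add: conj_by_eq_iff)
qed

section \<open>The abelian normal subgroup generated by the commutators\<close>

definition N where "N = generate G AB_commutators"

lemma AB_commutators_carrier: "AB_commutators \<subseteq> carrier G"
  by (auto simp: AB_commutators_def)

lemma N_normal: "N \<lhd> G"
  unfolding N_def
proof (rule normal_generateI[OF AB_commutators_carrier])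
  fix h g assume "h \<in> AB_commutators" "g \<in> carrier G"
  then show "g \<otimes> h \<otimes> inv g \<in> AB_commutators"
    using AB_commutators_conj[of h "inv g"] by (simp add: conj_by_def)
qed

lemma N_subgroup: "subgroup N G" using N_normal by (rule normal_imp_subgroup)

lemma N_carrier [simp]: "n \<in> N \<Longrightarrow> n \<in> carrier G"
  using N_subgroup by (rule subgroup.mem_carrier)

lemma N_conj: "n \<in> N \<Longrightarrow> g \<in> carrier G \<Longrightarrow> conj_by G n g \<in> N"
  using N_normal by (simp add: normal_conj_by_iff)

lemma commutator_in_N: "a \<in> A \<Longrightarrow> b \<in> B \<Longrightarrow> commutator a b \<in> N"
  unfolding N_def by (rule generate.incl) (auto simp: AB_commutators_def)

lemma N_comm: "x \<in> N \<Longrightarrow> y \<in> N \<Longrightarrow> x \<otimes> y = y \<otimes> x"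
  unfolding N_def by (rule generate_commute[OF AB_commutators_carrier AB_commutators_commute])
end

section \<open>The core-free case\<close>

locale corefree_factorization = abelian_factorization +
  assumes A_periodic: "\<And>a. a \<in> A \<Longrightarrow> \<exists>n::nat. n > 0 \<and> a [^] n = \<one>"
    and B_torsion_free: "\<And>b n. b \<in> B \<Longrightarrow> n > 0 \<Longrightarrow> b [^] (n::nat) = \<one> \<Longrightarrow> b = \<one>"
    and corefree: "\<And>M. M \<lhd> G \<Longrightarrow> M \<subseteq> A \<Longrightarrow> M = {\<one>}"
begin

text \<open>Since \<open>N\<close> is abelian and normal, its torsion elements form a normal
  subgroup \<open>T\<close> of G. If \<open>t = a \<otimes> b\<close> lies in \<open>T\<close>, a
  power of \<open>b = inv a \<otimes> t\<close> that kills \<open>inv a\<close> lies in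
  \<open>T\<close>, so \<open>b\<close> is torsion and hence trivial. Thus \<open>T\<close> lies in
  \<open>A\<close> and vanishes by \<open>corefree\<close>.\<close>

lemma N_torsion_free:
  assumes "t \<in> N" "n > 0" "t [^] (n::nat) = \<one>"
  shows "t = \<one>"
proof -
  define T where "T = {t \<in> N. \<exists>n::nat. n > 0 \<and> t [^] n = \<one>}"
  have T_sub: "subgroup T G"
  proof (rule subgroupI)
    show "T \<subseteq> carrier G" by (auto simp: T_def)
    have "\<one> \<in> T" using N_subgroup by (auto simp: T_def subgroup.one_closed intro!: exI[of _ 1])
    then show "T \<noteq> {}" by blast
  next
    fix x assume "x \<in> T"
    then show "inv x \<in> T" using N_subgroup
      by (auto simp: T_def subgroup.m_inv_closed nat_pow_inv)
  next
    fix x y assume "x \<in> T" "y \<in> T"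
    then obtain n m :: nat where xy: "x \<in> N" "y \<in> N" "n > 0" "m > 0" "x [^] n = \<one>" "y [^] m = \<one>"
      by (auto simp: T_def)
    have "(x \<otimes> y) [^] (n * m) = x [^] (n * m) \<otimes> y [^] (m * n)"
      using xy N_comm by (simp add: pow_mult_distrib mult.commute)
    also have "\<dots> = (x [^] n) [^] m \<otimes> (y [^] m) [^] n" using nat_pow_pow[of x n m] nat_pow_pow[of y m n] xy(1,2) by simp
    also have "\<dots> = \<one>" using xy by simp
    finally show "x \<otimes> y \<in> T" using xy N_subgroup
      by (auto simp: T_def subgroup.m_closed intro!: exI[of _ "n * m"])
  qed
  have T_normal: "T \<lhd> G"
    unfolding normal_conj_by_iff
  proof (intro conjI ballI T_sub)
    fix g x assume "g \<in> carrier G" "x \<in> T"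
    then show "conj_by G x g \<in> T"
      by (auto simp: T_def N_conj simp flip: conj_by_pow)
  qed
  have "T \<subseteq> A"
  proof
    fix t assume t: "t \<in> T"
    then have tG: "t \<in> carrier G" by (simp add: T_def)
    obtain a b where ab: "a \<in> A" "b \<in> B" "t = a \<otimes> b" using factor[OF tG] by blast
    obtain k :: nat where k: "k > 0" "inv a [^] k = \<one>"
      using A_periodic[of "inv a"] ab A by (auto simp: subgroup.m_inv_closed)
    obtain s where s: "s \<in> T" "(inv a \<otimes> t) [^] k = inv a [^] k \<otimes> s"
      using mult_pow_normal[OF T_normal inv_closed[OF A_carrier[OF ab(1)]] t, of k] by blast
    have "inv a \<otimes> t = b" using ab by simp
    then have "b [^] k \<in> T" using s k by (simp add: T_def)
    then obtain m :: nat where "m > 0" "(b [^] k) [^] m = \<one>" by (auto simp: T_def)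
    then have "b [^] (k * m) = \<one>" "k * m > 0" using ab k by (simp_all add: nat_pow_pow)
    then have "b = \<one>" using B_torsion_free ab by blast
    then show "t \<in> A" using ab by simp
  qed
  then have "T = {\<one>}" using T_normal corefree by blast
  then show ?thesis using assms by (auto simp: T_def)
qed

lemma N_pow_inject:
  assumes "x \<in> N" "y \<in> N" "k > 0" "x [^] (k::nat) = y [^] k"
  shows "x = y"
proof -
  have i: "inv y \<in> N" using assms N_subgroup by (simp add: subgroup.m_inv_closed)
  have "(x \<otimes> inv y) [^] k = x [^] k \<otimes> inv y [^] k"
    using assms i by (intro pow_mult_distrib N_comm) auto
  also have "\<dots> = \<one>" using assms by (simp add: nat_pow_inv)
  finally have "x \<otimes> inv y = \<one>" using N_torsion_free assms i N_subgroup by (meson subgroup.m_closed)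
  then show ?thesis using assms by (simp add: inv_solve_right')
qed

text \<open>The centralizer \<open>M\<close> of \<open>N\<close> in \<open>A\<close> turns out to be
  central in G. For \<open>a\<close> in \<open>M\<close> and \<open>b\<close> in \<open>B\<close>,
  the conjugate of \<open>a\<close> by \<open>b\<close> is \<open>a \<otimes> x\<close> with
  \<open>x\<close> in \<open>N\<close> commuting with \<open>a\<close>. A power killing
  \<open>a\<close> also kills its conjugate, hence \<open>x\<close>, and \<open>N\<close> is
  torsion-free. So \<open>M\<close> is normal and contained in \<open>A\<close>.\<close>

lemma centralizer_N_trivial:
  assumes "a \<in> A" "\<And>n. n \<in> N \<Longrightarrow> conj_by G n a = n"
  shows "a = \<one>"
proof -
  define M where "M = {a \<in> A. \<forall>n\<in>N. conj_by G n a = n}"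
  have central: "conj_by G a g = a" if a: "a \<in> M" and g: "g \<in> carrier G" for a g
  proof -
    have aA: "a \<in> A" and aN: "\<And>n. n \<in> N \<Longrightarrow> conj_by G n a = n" using a by (auto simp: M_def)
    obtain a' b where ab: "a' \<in> A" "b \<in> B" "g = a' \<otimes> b" using factor[OF g] by blast
    define x where "x = commutator a b"
    have xN: "x \<in> N" unfolding x_def using aA ab by (intro commutator_in_N)
    have ax: "conj_by G a b = a \<otimes> x" using aA ab by (simp add: x_def commutator_def conj_by_def m_assoc)
    obtain k :: nat where k: "k > 0" "a [^] k = \<one>" using A_periodic aA by blast
    have "a \<otimes> x = x \<otimes> a" using aN[OF xN] xN aA by (simp add: conj_by_eq_iff)
    then have "(a \<otimes> x) [^] k = a [^] k \<otimes> x [^] k" using aA xN by (intro pow_mult_distrib) auto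
    moreover have "(a \<otimes> x) [^] k = \<one>" using aA ab k by (simp flip: ax conj_by_pow)
    ultimately have "x [^] k = \<one>" using k xN by simp
    then have "x = \<one>" using N_torsion_free xN k by blast
    then have "conj_by G a b = a" using ax aA by simp
    moreover have "conj_by G a a' = a" using A_comm aA ab by (simp add: conj_by_eq_iff)
    ultimately show ?thesis using aA ab by (simp flip: conj_by_conj_by)
  qed
  have "subgroup M G"
  proof (rule subgroupI)
    show "M \<subseteq> carrier G" by (auto simp: M_def)
    have "\<one> \<in> M" using A by (auto simp: M_def subgroup.one_closed)
    then show "M \<noteq> {}" by blast
  next
    fix a assume a: "a \<in> M"
    then have "conj_by G n (inv a) = n" if "n \<in> N" for n
      using that conj_by_conj_by[of n a "inv a"] by (auto simp: M_def)
    then show "inv a \<in> M" using a A by (auto simp: M_def subgroup.m_inv_closed)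
  next
    fix a b assume "a \<in> M" "b \<in> M"
    then show "a \<otimes> b \<in> M" using A by (auto simp: M_def subgroup.m_closed simp flip: conj_by_conj_by)
  qed
  then have "M \<lhd> G" using central by (simp add: normal_conj_by_iff)
  then have "M = {\<one>}" using corefree by (auto simp: M_def)
  then show ?thesis using assms by (auto simp: M_def)
qed

lemma finite_powers:
  assumes "a \<in> A"
  shows "finite (range (\<lambda>i::nat. a [^] i))"
proof -
  obtain k :: nat where k: "k > 0" "a [^] k = \<one>" using A_periodic assms by blast
  have "a [^] i \<in> (\<lambda>i. a [^] i) ` {..<k}" for i :: nat
  proof -
    have "a [^] i = a [^] (k * (i div k) + i mod k)" by simp
    also have "\<dots> = (a [^] k) [^] (i div k) \<otimes> a [^] (i mod k)"
      using assms by (simp only: nat_pow_mult nat_pow_pow A_carrier nat_pow_closed)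
    also have "\<dots> = a [^] (i mod k)" using k assms by simp
    finally show ?thesis using k by auto
  qed
  then have "range (\<lambda>i::nat. a [^] i) \<subseteq> (\<lambda>i. a [^] i) ` {..<k}" by (rule image_subsetI)
  then show ?thesis by (rule finite_subset) simp
qed

text \<open>The conjugate of \<open>n\<close> by \<open>a\<close> is the midpoint of
  \<open>n\<close> and its conjugate by a suitable \<open>a'\<close>. Conjugation by elements of
  \<open>A\<close> preserves this relation, so it can be moved until the midpoint is an extreme
  point of the finite orbit, where the relation degenerates.\<close>

lemma A_centralizes:
  assumes n: "n \<in> N" and a: "a \<in> A" "a \<otimes> n \<in> B"
  shows "conj_by G n a = n"
proof -
  have nG: "n \<in> carrier G" using n by simp
  obtain a0 b0 where ab0: "a0 \<in> A" "b0 \<in> B" "n \<otimes> n = a0 \<otimes> b0" using factor[of "n \<otimes> n"] nG by auto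
  \<comment> \<open>Cancelling the \<open>A\<close>-part of \<open>n \<otimes> n\<close> leaves an
    element of \<open>B\<close>.\<close>
  define a' where "a' = inv a0"
  have a': "a' \<in> A" using ab0 A by (simp add: a'_def subgroup.m_inv_closed)
  have a'n: "a' \<otimes> (n \<otimes> n) \<in> B" using ab0 by (simp add: a'_def)
  note [simp] = a(1) a'
  let ?T = "\<lambda>x. conj_by G x a" and ?T' = "\<lambda>x. conj_by G x a'"
  have "(a \<otimes> a') \<otimes> (?T' n \<otimes> n \<otimes> n) = (a \<otimes> n) \<otimes> (a' \<otimes> (n \<otimes> n))"
    using nG by (simp add: conj_by_def m_assoc)
  also have "\<dots> = (a' \<otimes> (n \<otimes> n)) \<otimes> (a \<otimes> n)" using B_comm a(2) a'n by blast
  also have "\<dots> = (a' \<otimes> a) \<otimes> (?T n \<otimes> ?T n \<otimes> n)"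
    using nG by (simp add: conj_by_def m_assoc)
  also have "a' \<otimes> a = a \<otimes> a'" by (rule A_comm) simp_all
  finally have mid: "?T' n \<otimes> n = ?T n \<otimes> ?T n" using nG by simp
  let ?Q = "\<lambda>(u, v). conj_by G n (u \<otimes> v)"
  \<comment> \<open>The orbit of \<open>n\<close> under the group generated by \<open>a\<close> and
    \<open>a'\<close>; natural exponents suffice because both elements have finite order.\<close>
  define S where "S = ?Q ` (range (\<lambda>i::nat. a [^] i) \<times> range (\<lambda>i::nat. a' [^] i))"
  have S_I: "conj_by G n (a [^] i \<otimes> a' [^] j) \<in> S" for i j :: nat by (force simp: S_def)
  have "finite S" unfolding S_def by (intro finite_imageI finite_cartesian_product finite_powers a(1) a')
  have SN: "S \<subseteq> N" using n by (auto simp: S_def N_conj)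
  let ?GN = "G\<lparr>carrier := N\<rparr>"
  have GN: "comm_group ?GN"
    using subgroup.subgroup_is_group[OF N_subgroup is_group]
    by (rule group.group_comm_groupI) (simp add: N_comm)
  have "torsion_free ?GN"
    unfolding torsion_free_def by (auto simp: N_torsion_free simp flip: nat_pow_consistent)
  moreover have "S \<noteq> {}" using S_I by blast
  ultimately obtain e where e: "e \<in> S" "\<And>y z. y \<in> S \<Longrightarrow> z \<in> S \<Longrightarrow> y \<otimes> z = e \<otimes> e \<Longrightarrow> y = e"
    using comm_group.exists_extreme_point[OF GN _ \<open>finite S\<close>] SN by auto
  then obtain i j :: nat where ij: "e = conj_by G n (a [^] i \<otimes> a' [^] j)" by (auto simp: S_def)
  obtain k :: nat where k: "k > 0" "a [^] k = \<one>" using A_periodic a(1) by blast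
  then obtain k' where k': "k = Suc k'" by (cases k) auto
  \<comment> \<open>Since \<open>k = Suc k'\<close>, the factor \<open>a [^] k'\<close> is the
    inverse of \<open>a\<close>, so \<open>g \<otimes> a\<close> is the element that carries
    \<open>n\<close> to the extreme point \<open>e\<close>.\<close>
  define g where "g = a [^] (i + k') \<otimes> a' [^] j"
  define x where "x = conj_by G n g"
  have pA: "u [^] l \<in> A" if "u \<in> A" for u and l :: nat
    using A that by (induction l) (auto simp: subgroup.one_closed subgroup.m_closed)
  have gA: "g \<in> A" unfolding g_def by (intro subgroup.m_closed[OF A] pA a(1) a')
  note [simp] = gA
  have xS: "x \<in> S" unfolding x_def g_def by (rule S_I)
  have "g \<otimes> a' = a [^] (i + k') \<otimes> a' [^] Suc j" by (simp add: g_def m_assoc)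
  then have x'S: "?T' x \<in> S" unfolding x_def using nG S_I[of "i + k'" "Suc j"] by (simp add: conj_by_conj_by)
  have "a' [^] j \<otimes> a = a \<otimes> a' [^] j" by (intro A_comm pA) simp_all
  then have "g \<otimes> a = a [^] (i + k) \<otimes> a' [^] j"
    by (simp add: g_def k' m_assoc)
  also have "a [^] (i + k) = a [^] i" using k(2) by (simp flip: nat_pow_mult)
  finally have xe: "?T x = e" using nG by (simp add: x_def conj_by_conj_by ij)
  have swap: "conj_by G (conj_by G n u) g = conj_by G x u" if "u \<in> A" for u
    using nG that A_comm[of g u] by (simp add: x_def conj_by_conj_by)
  \<comment> \<open>Translating the midpoint relation by \<open>g\<close> puts \<open>e\<close> in
    the middle, so extremality yields \<open>x = e\<close>; conjugating back by \<open>inv g\<close>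
    gives the claim.\<close>
  have "conj_by G (?T' n \<otimes> n) g = conj_by G (?T n \<otimes> ?T n) g" by (simp only: mid)
  then have "?T' x \<otimes> x = e \<otimes> e"
    using nG xe by (simp add: conj_by_mult swap flip: x_def)
  moreover have "?T' x \<otimes> x = x \<otimes> ?T' x" using xS x'S SN by (intro N_comm) auto
  ultimately have "x = e" using e(2)[OF xS x'S] by simp
  then have "conj_by G (?T n) g = conj_by G n g"
    using xe swap[OF a(1)] by (simp flip: x_def)
  then have "conj_by G (conj_by G (?T n) g) (inv g) = conj_by G (conj_by G n g) (inv g)" by simp
  then show ?thesis using nG by (simp add: conj_by_conj_by m_assoc)
qed

text \<open>Write \<open>b = a \<otimes> n\<close> with \<open>b\<close> in \<open>B\<close>. As
  \<open>a\<close> commutes with \<open>n\<close> and has finite order, some powers of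
  \<open>b\<close> and \<open>n\<close> coincide. Every \<open>y\<close> in \<open>B\<close> fixes
  this power, and roots in \<open>N\<close> are unique.\<close>

lemma B_centralizes_N:
  assumes n: "n \<in> N" and y: "y \<in> B"
  shows "conj_by G n y = n"
proof -
  have nG: "n \<in> carrier G" using n by simp
  obtain a0 b where ab0: "a0 \<in> A" "b \<in> B" "n = a0 \<otimes> b" using factor[OF nG] by blast
  define a where "a = inv a0"
  have a: "a \<in> A" using ab0 A by (simp add: a_def subgroup.m_inv_closed)
  have an: "a \<otimes> n = b" using ab0 by (simp add: a_def)
  have na: "conj_by G n a = n" using n a an ab0 by (intro A_centralizes) simp_all
  then have comm: "a \<otimes> n = n \<otimes> a" using nG a by (simp add: conj_by_eq_iff)
  obtain k :: nat where k: "k > 0" "a [^] k = \<one>" using A_periodic a by blast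
  have bk: "b [^] k = n [^] k" using comm k nG a by (simp add: pow_mult_distrib flip: an)
  show ?thesis
  proof (rule N_pow_inject[OF _ n k(1)])
    show "conj_by G n y \<in> N" using n y by (simp add: N_conj)
    have "conj_by G b y = b" using B_comm y ab0 by (simp add: conj_by_eq_iff)
    then have "conj_by G (b [^] k) y = b [^] k" using y ab0 by (simp add: conj_by_pow)
    then show "conj_by G n y [^] k = n [^] k" using nG y by (simp add: bk conj_by_pow)
  qed
qed

text \<open>In \<open>n = a \<otimes> b\<close> both \<open>n\<close> and \<open>b\<close>
  centralize \<open>N\<close>, so \<open>a\<close> does too and is trivial.\<close>

lemma N_subset_B: "N \<subseteq> B"
proof
  fix n assume n: "n \<in> N"
  have nG: "n \<in> carrier G" using n by simp
  obtain a b where ab: "a \<in> A" "b \<in> B" "n = a \<otimes> b" using factor[OF nG] by blast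
  have a: "a = n \<otimes> inv b" using ab by (simp add: m_assoc)
  have "conj_by G m a = m" if m: "m \<in> N" for m
  proof -
    have "conj_by G m n = m" using N_comm m n by (simp add: conj_by_eq_iff)
    moreover have "conj_by G m (inv b) = m"
      using ab B m by (intro B_centralizes_N) (simp_all add: subgroup.m_inv_closed)
    ultimately show ?thesis using ab m nG unfolding a by (simp flip: conj_by_conj_by)
  qed
  then have "a = \<one>" using ab by (intro centralizer_N_trivial)
  then show "n \<in> B" using ab by simp
qed

text \<open>Conjugation by \<open>a\<close> changes \<open>b\<close> by the inverse of a commutator,
  which lies in \<open>N\<close> and thus in \<open>B\<close>.\<close>

lemma B_conj_A:
  assumes "b \<in> B" "a \<in> A"
  shows "conj_by G b a \<in> B"
proof -
  have "commutator a b \<in> B" using assms commutator_in_N N_subset_B by blast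
  then have "b \<otimes> inv (commutator a b) \<in> B"
    using assms B by (simp add: subgroup.m_closed subgroup.m_inv_closed)
  also have "b \<otimes> inv (commutator a b) = conj_by G b a"
    using assms by (simp add: commutator_def conj_by_def m_assoc inv_mult_group)
  finally show ?thesis .
qed

section \<open>Automorphisms of \<open>B\<close> induced by elements of finite order\<close>

lemma B_int_pow_eq_one:
  assumes "x \<in> B" "x [^] (i::int) = \<one>" "i \<noteq> 0"
  shows "x = \<one>"
proof (rule B_torsion_free[OF assms(1)])
  show "nat \<bar>i\<bar> > 0" using assms(3) by simp
  show "x [^] nat \<bar>i\<bar> = \<one>"
    using assms(1,2) by (cases "i \<ge> 0") (auto simp: int_pow_def2 simp del: pow_nat)
qed

lemma B_int_pow_inject:
  assumes "x \<in> B" "y \<in> B" "x [^] (i::int) = y [^] i" "i \<noteq> 0"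
  shows "x = y"
proof -
  have i: "inv y \<in> B" using assms B by (simp add: subgroup.m_inv_closed)
  have "(x \<otimes> inv y) [^] i = x [^] i \<otimes> inv y [^] i"
    using assms i by (intro int_pow_mult_distrib B_comm) auto
  also have "\<dots> = \<one>" using assms by (simp add: int_pow_inv)
  finally have "x \<otimes> inv y = \<one>" using B_int_pow_eq_one assms i B by (meson subgroup.m_closed)
  then show ?thesis using assms by (simp add: inv_solve_right')
qed

text \<open>The hypothesis \<open>rank\<close> is the form in which local cyclicity of
  \<open>B\<close> reaches the quotient by the core. Conjugation by \<open>a\<close> multiplies
  exponents by the rational number j/i; finite order of \<open>a\<close> forces i and j to have
  equal absolute values.\<close>

lemma conj_B_sign:
  assumes rank: "\<And>b c. b \<in> B \<Longrightarrow> c \<in> B \<Longrightarrow> \<exists>z\<in>B. \<exists>(i::int) (j::int). b = z [^] i \<and> c = z [^] j"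
    and a: "a \<in> A" and x: "x \<in> B"
  shows "conj_by G x a = x \<or> conj_by G x a = inv x"
proof (cases "x = \<one>")
  case True
  then show ?thesis using a by simp
next
  case False
  let ?y = "conj_by G x a"
  have yB: "?y \<in> B" using x a by (rule B_conj_A)
  obtain z i j where z: "z \<in> B" "x = z [^] (i::int)" "?y = z [^] (j::int)"
    using rank[OF x yB] by blast
  have i: "i \<noteq> 0" using z False by auto
  have yi: "?y [^] i = x [^] j"
    using z by (simp only: int_pow_pow B_carrier mult.commute)
  \<comment> \<open>The m-th iterate of multiplication by j/i, with the denominator cleared.\<close>
  have iter: "conj_by G x (a [^] m) [^] (i ^ m) = x [^] (j ^ m)" for m :: nat
  proof (induction m)
    case (Suc m)
    have "conj_by G x (a [^] Suc m) [^] (i ^ Suc m) = (conj_by G (conj_by G x (a [^] m)) a [^] (i ^ m)) [^] i"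
      using x a by (simp add: conj_by_conj_by int_pow_pow mult.commute)
    also have "\<dots> = conj_by G (conj_by G x (a [^] m) [^] (i ^ m)) a [^] i"
      using x a by (simp add: conj_by_int_pow)
    also have "\<dots> = (?y [^] i) [^] (j ^ m)"
      using x a by (simp add: Suc conj_by_int_pow int_pow_pow mult.commute)
    also have "\<dots> = x [^] (j ^ Suc m)" using x by (simp add: yi int_pow_pow)
    finally show ?case .
  qed (use x in simp)
  obtain k :: nat where k: "k > 0" "a [^] k = \<one>" using A_periodic a by blast
  have "x [^] (i ^ k - j ^ k) = \<one>"
    using iter[of k] k x by (simp add: int_pow_diff)
  then have "i ^ k = j ^ k" using B_int_pow_eq_one[OF x] False by fastforce
  then have "\<bar>i\<bar> ^ k = \<bar>j\<bar> ^ k" by (metis power_abs)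
  then have "\<bar>i\<bar> = \<bar>j\<bar>" using k(1) by (metis abs_ge_zero power_eq_imp_eq_base)
  then have "j = i \<or> j = - i" by arith
  then have "?y [^] i = x [^] i \<or> ?y [^] i = inv x [^] i"
    using yi x by (auto simp: int_pow_neg int_pow_inv)
  moreover have "inv x \<in> B" using x B by (simp add: subgroup.m_inv_closed)
  ultimately show ?thesis using B_int_pow_inject yB x i by blast
qed

text \<open>The sign is the same for all elements: any \<open>c\<close> has a common root
  \<open>z\<close> with a moved element \<open>b\<close>. This root is moved as well, hence
  inverted, and so is \<open>c\<close>.\<close>

lemma conj_B_cases:
  assumes rank: "\<And>b c. b \<in> B \<Longrightarrow> c \<in> B \<Longrightarrow> \<exists>z\<in>B. \<exists>(i::int) (j::int). b = z [^] i \<and> c = z [^] j"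
    and a: "a \<in> A"
  shows "(\<forall>b\<in>B. conj_by G b a = b) \<or> (\<forall>b\<in>B. conj_by G b a = inv b)"
proof (cases "\<forall>b\<in>B. conj_by G b a = b")
  case False
  then obtain b where b: "b \<in> B" "conj_by G b a \<noteq> b" by blast
  have "conj_by G c a = inv c" if c: "c \<in> B" for c
  proof -
    obtain z i j where z: "z \<in> B" "b = z [^] (i::int)" "c = z [^] (j::int)"
      using rank[OF b(1) c] by blast
    have "conj_by G z a \<noteq> z" using z b(2) a by (auto simp: conj_by_int_pow)
    then have "conj_by G z a = inv z" using conj_B_sign[OF rank a z(1)] by blast
    then show ?thesis using z a by (simp add: conj_by_int_pow int_pow_inv)
  qed
  then show ?thesis by blast
qed blast

end

section \<open>The quotient by the core\<close>

text \<open>The element \<open>z\<close> is a generator of the cyclic subgroup generated by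
  \<open>x\<close> and \<open>y\<close>. Local cyclicity is used only through this
  consequence.\<close>

lemma (in group) locally_cyclic_common_root:
  assumes H: "subgroup H G" and lc: "locally_cyclic (G\<lparr>carrier := H\<rparr>)"
    and xy: "x \<in> H" "y \<in> H"
  shows "\<exists>z\<in>H. \<exists>(i::int) (j::int). x = z [^] i \<and> y = z [^] j"
proof -
  let ?H = "G\<lparr>carrier := H\<rparr>"
  interpret H: group ?H using H is_group by (rule subgroup.subgroup_is_group)
  define C where "C = generate ?H {x, y}"
  have C: "subgroup_generated ?H {x, y} = G\<lparr>carrier := C\<rparr>"
    using xy by (simp add: subgroup_generated_def C_def)
  have "subgroup C ?H" unfolding C_def using xy by (intro H.generate_is_subgroup) simp
  then have CG: "subgroup C G" and CH: "C \<subseteq> H"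
    using incl_subgroup[OF H] subgroup.subset by fastforce+
  have xyC: "x \<in> C" "y \<in> C" unfolding C_def by (auto intro: generate.incl)
  have "cyclic_group (G\<lparr>carrier := C\<rparr>)"
    using lc xy unfolding locally_cyclic_def by (simp flip: C)
  then obtain z where z: "z \<in> C" "C = range (\<lambda>n::int. z [^]\<^bsub>G\<lparr>carrier := C\<rparr>\<^esub> n)"
    using group.cyclic_group[OF subgroup.subgroup_is_group[OF CG is_group]] by auto
  then have "C = range (\<lambda>n::int. z [^] n)" using int_pow_consistent[OF CG z(1)] by simp
  then obtain i j :: int where "x = z [^] i" "y = z [^] j" using xyC by (metis imageE)
  then show ?thesis using z(1) CH by blast
qed

lemma (in group) locally_cyclic_commute:
  assumes "subgroup H G" "locally_cyclic (G\<lparr>carrier := H\<rparr>)" "x \<in> H" "y \<in> H"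
  shows "x \<otimes> y = y \<otimes> x"
proof -
  obtain z and i j :: int where "z \<in> H" "x = z [^] i" "y = z [^] j"
    using locally_cyclic_common_root[OF assms] by blast
  then show ?thesis
    using subgroup.mem_carrier[OF assms(1)] by (simp add: add.commute flip: int_pow_mult)
qed

lemma (in group_hom) hom_conj_by:
  "\<lbrakk>x \<in> carrier G; g \<in> carrier G\<rbrakk> \<Longrightarrow> h (conj_by G x g) = conj_by H (h x) (h g)"
  by (simp add: conj_by_def)

lemma (in group_hom) normal_vimage:
  assumes "M \<lhd> H"
  shows "{x \<in> carrier G. h x \<in> M} \<lhd> G"
proof -
  have M: "subgroup M H" using assms by (rule normal_imp_subgroup)
  have "subgroup {x \<in> carrier G. h x \<in> M} G"
  proof (rule G.subgroupI)
    have "\<one> \<in> {x \<in> carrier G. h x \<in> M}" using M by (simp add: subgroup.one_closed)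
    then show "{x \<in> carrier G. h x \<in> M} \<noteq> {}" by blast
  qed (use M in \<open>auto simp: subgroup.m_closed subgroup.m_inv_closed\<close>)
  then show ?thesis
    using assms by (simp add: G.normal_conj_by_iff H.normal_conj_by_iff hom_conj_by)
qed

lemma (in normal) r_coset_eq_iff:
  assumes "x \<in> carrier G" "y \<in> carrier G"
  shows "H #> x = H #> y \<longleftrightarrow> (\<exists>k\<in>H. x = k \<otimes> y)"
proof
  assume "H #> x = H #> y"
  then have "x \<in> H #> y" using rcos_self[OF assms(1) subgroup_axioms] by simp
  then show "\<exists>k\<in>H. x = k \<otimes> y" by (auto simp: r_coset_def)
next
  assume "\<exists>k\<in>H. x = k \<otimes> y"
  then have "x \<in> H #> y" by (auto simp: r_coset_def)
  then show "H #> x = H #> y" using repr_independence assms subgroup_axioms by blast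
qed

section \<open>The largest normal subgroup of G inside \<open>A\<close>\<close>

context abelian_factorization begin

text \<open>The intersection of all conjugates of \<open>A\<close>, described elementwise.\<close>

definition core where "core = {x \<in> A. \<forall>g\<in>carrier G. conj_by G x g \<in> A}"

lemma core_subset: "core \<subseteq> A" by (auto simp: core_def)

lemma core_normal: "core \<lhd> G"
proof -
  have "subgroup core G"
  proof (rule subgroupI)
    show "core \<subseteq> carrier G" by (auto simp: core_def)
    have "\<one> \<in> core" using A by (auto simp: core_def subgroup.one_closed)
    then show "core \<noteq> {}" by blast
  qed (use A in \<open>auto simp: core_def conj_by_inv conj_by_mult subgroup.m_closed subgroup.m_inv_closed\<close>)
  moreover have "conj_by G x g \<in> core" if "g \<in> carrier G" "x \<in> core" for g x
    using that by (auto simp: core_def conj_by_conj_by)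
  ultimately show ?thesis by (simp add: normal_conj_by_iff)
qed

lemma core_greatest: "M \<lhd> G \<Longrightarrow> M \<subseteq> A \<Longrightarrow> M \<subseteq> core"
  by (auto simp: core_def normal_conj_by_iff)

text \<open>In g = ab the factor from \<open>A\<close> acts first, and it fixes \<open>x\<close>
  because \<open>A\<close> is abelian; only conjugation by \<open>B\<close> remains to be
  checked.\<close>

lemma core_memI:
  assumes "x \<in> A" "\<And>b. b \<in> B \<Longrightarrow> conj_by G x b \<in> A"
  shows "x \<in> core"
proof -
  have "conj_by G x g \<in> A" if "g \<in> carrier G" for g
  proof -
    obtain a b where ab: "a \<in> A" "b \<in> B" "g = a \<otimes> b" using factor \<open>g \<in> carrier G\<close> by blast
    have "conj_by G x a = x" using ab assms(1) A_comm by (simp add: conj_by_eq_iff)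
    then show ?thesis using ab assms by (simp flip: conj_by_conj_by)
  qed
  then show ?thesis using assms(1) by (simp add: core_def)
qed

end

text \<open>Local cyclicity of both factors enters as commutativity, that of \<open>B\<close> also
  as \<open>B_common_root\<close>.\<close>

locale periodic_by_rank_one = abelian_factorization +
  assumes A_periodic: "\<And>a. a \<in> A \<Longrightarrow> \<exists>n::nat. n > 0 \<and> a [^] n = \<one>"
    and B_torsion_free: "\<And>b n. b \<in> B \<Longrightarrow> n > 0 \<Longrightarrow> b [^] (n::nat) = \<one> \<Longrightarrow> b = \<one>"
    and B_common_root: "\<And>b c. b \<in> B \<Longrightarrow> c \<in> B \<Longrightarrow> \<exists>z\<in>B. \<exists>(i::int) (j::int). b = z [^] i \<and> c = z [^] j"
begin

sublocale core: normal core G by (rule core_normal)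

abbreviation Q where "Q \<equiv> G Mod core"

abbreviation proj where "proj x \<equiv> core #> x"

sublocale proj: group_hom G Q proj
  unfolding group_hom_def group_hom_axioms_def
  using is_group core.factorgroup_is_group core.r_coset_hom_Mod by blast

lemma core_carrier [simp]: "x \<in> core \<Longrightarrow> x \<in> carrier G"
  using core_subset by auto

lemma carrier_Q: "carrier Q = proj ` carrier G"
  by (auto simp: FactGroup_def RCOSETS_def)

text \<open>The image of \<open>B\<close> stays torsion-free: if a power of \<open>b\<close> falls
  into the core it lies in \<open>A\<close>, so \<open>b\<close> is torsion. The image of
  \<open>A\<close> is core-free: as the core lies in \<open>A\<close>, a normal subgroup inside this
  image pulls back to a normal subgroup of G inside \<open>A\<close>, hence into the core.\<close>

lemma corefree_quotient: "corefree_factorization Q (proj ` A) (proj ` B)"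
proof (intro corefree_factorization.intro abelian_factorization.intro
    abelian_factorization_axioms.intro corefree_factorization_axioms.intro)
  show "group Q" by (rule proj.H.is_group)
  show "subgroup (proj ` A) Q" "subgroup (proj ` B) Q"
    using A B by (auto intro: proj.subgroup_img_is_subgroup)
next
  fix g assume "g \<in> carrier Q"
  then obtain x where x: "x \<in> carrier G" "g = proj x" unfolding carrier_Q by blast
  obtain a b where ab: "a \<in> A" "b \<in> B" "x = a \<otimes> b" using factor[OF x(1)] by blast
  have "g = proj a \<otimes>\<^bsub>Q\<^esub> proj b"
    unfolding x(2) ab(3) using ab by (intro proj.hom_mult) simp_all
  with ab show "\<exists>a\<in>proj ` A. \<exists>b\<in>proj ` B. g = a \<otimes>\<^bsub>Q\<^esub> b" by blast
next
  fix x y assume "x \<in> proj ` A" "y \<in> proj ` A"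
  then obtain a b where "a \<in> A" "b \<in> A" "x = proj a" "y = proj b" by blast
  then show "x \<otimes>\<^bsub>Q\<^esub> y = y \<otimes>\<^bsub>Q\<^esub> x" by (metis A_carrier A_comm proj.hom_mult)
next
  fix x y assume "x \<in> proj ` B" "y \<in> proj ` B"
  then obtain a b where "a \<in> B" "b \<in> B" "x = proj a" "y = proj b" by blast
  then show "x \<otimes>\<^bsub>Q\<^esub> y = y \<otimes>\<^bsub>Q\<^esub> x" by (metis B_carrier B_comm proj.hom_mult)
next
  fix x assume "x \<in> proj ` A"
  then obtain a where a: "a \<in> A" "x = proj a" by blast
  then obtain n :: nat where "n > 0" "a [^] n = \<one>" using A_periodic by blast
  then show "\<exists>n::nat. n > 0 \<and> x [^]\<^bsub>Q\<^esub> n = \<one>\<^bsub>Q\<^esub>"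
    using a by (intro exI[of _ n]) (simp flip: proj.hom_nat_pow del: one_FactGroup)
next
  fix x and n :: nat assume x: "x \<in> proj ` B" and n: "n > 0" and eq: "x [^]\<^bsub>Q\<^esub> n = \<one>\<^bsub>Q\<^esub>"
  obtain b where b: "b \<in> B" "x = proj b" using x by blast
  have "proj (b [^] n) = proj \<one>" using b eq by (simp add: proj.hom_nat_pow del: one_FactGroup)
  then obtain k where k: "k \<in> core" "b [^] n = k \<otimes> \<one>"
    using core.r_coset_eq_iff[of "b [^] n" \<one>] b by auto
  then have "b [^] n \<in> A" using core_subset by auto
  then obtain m :: nat where m: "m > 0" "(b [^] n) [^] m = \<one>" using A_periodic by blast
  then have "b [^] (n * m) = \<one>" using b by (simp add: nat_pow_pow)
  then have "b = \<one>" using B_torsion_free[of b "n * m"] b m n by simp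
  then show "x = \<one>\<^bsub>Q\<^esub>" using b proj.hom_one by simp
next
  fix M assume M: "M \<lhd> Q" "M \<subseteq> proj ` A"
  define M' where "M' = {x \<in> carrier G. proj x \<in> M}"
  have "M' \<lhd> G" unfolding M'_def using M(1) by (rule proj.normal_vimage)
  moreover have "M' \<subseteq> A"
  proof
    fix x assume "x \<in> M'"
    then obtain a where "x \<in> carrier G" "a \<in> A" "proj x = proj a" using M(2) by (auto simp: M'_def)
    then obtain k where "k \<in> core" "x = k \<otimes> a" using core.r_coset_eq_iff by auto
    then show "x \<in> A" using core_subset \<open>a \<in> A\<close> A by (auto intro: subgroup.m_closed)
  qed
  ultimately have M'_core: "M' \<subseteq> core" by (rule core_greatest)
  have "x = \<one>\<^bsub>Q\<^esub>" if x: "x \<in> M" for x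
  proof -
    obtain a where a: "a \<in> A" "x = proj a" using M(2) x by blast
    then have "a \<in> core" using M'_core x by (auto simp: M'_def)
    then show ?thesis using a core.subgroup_axioms by (simp add: coset_join2)
  qed
  then show "M = {\<one>\<^bsub>Q\<^esub>}"
    using subgroup.one_closed[OF normal_imp_subgroup[OF M(1)]] by blast
qed

lemma conj_B_cases_mod_core:
  assumes a: "a \<in> A"
  shows "(\<forall>b\<in>B. proj (conj_by G b a) = proj b) \<or> (\<forall>b\<in>B. proj (conj_by G b a) = proj (inv b))"
proof -
  interpret q: corefree_factorization Q "proj ` A" "proj ` B" by (rule corefree_quotient)
  have root: "\<exists>z\<in>proj ` B. \<exists>(i::int) (j::int). u = z [^]\<^bsub>Q\<^esub> i \<and> v = z [^]\<^bsub>Q\<^esub> j"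
    if uv: "u \<in> proj ` B" "v \<in> proj ` B" for u v
  proof -
    obtain b c where bc: "b \<in> B" "c \<in> B" "u = proj b" "v = proj c" using uv by blast
    then obtain z and i j :: int where z: "z \<in> B" "b = z [^] i" "c = z [^] j"
      using B_common_root by blast
    then have "u = proj z [^]\<^bsub>Q\<^esub> i" "v = proj z [^]\<^bsub>Q\<^esub> j"
      using bc by (simp_all add: proj.hom_int_pow)
    then show ?thesis using z(1) by blast
  qed
  have "(\<forall>x\<in>proj ` B. conj_by Q x (proj a) = x) \<or> (\<forall>x\<in>proj ` B. conj_by Q x (proj a) = inv\<^bsub>Q\<^esub> x)"
    using root imageI[OF a] by (rule q.conj_B_cases)
  then show ?thesis using a by (auto simp: proj.hom_conj_by)
qed

text \<open>Applied to \<open>inv b\<close>, the hypothesis says that conjugating \<open>a\<close>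
  by \<open>b\<close> multiplies it by an element of the core, so the conjugate stays in
  \<open>A\<close>.\<close>

lemma core_memI_centralizing:
  assumes a: "a \<in> A" and "\<And>b. b \<in> B \<Longrightarrow> proj (conj_by G b a) = proj b"
  shows "a \<in> core"
proof (rule core_memI[OF a])
  fix b assume b: "b \<in> B"
  then have ib: "inv b \<in> B" using B by (simp add: subgroup.m_inv_closed)
  with assms(2) obtain k where k: "k \<in> core" "conj_by G (inv b) a = k \<otimes> inv b"
    using core.r_coset_eq_iff[of "conj_by G (inv b) a" "inv b"] a b by auto
  then have "inv b \<otimes> a = a \<otimes> (k \<otimes> inv b)" using a b by (simp add: conj_by_eq_iff)
  then have "conj_by G a b = a \<otimes> k" using a b k by (simp add: conj_by_def m_assoc)
  then show "conj_by G a b \<in> A" using k core_subset a A by (auto intro: subgroup.m_closed)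
qed

lemma conj_B_mod_core:
  assumes "a \<in> A" "a \<notin> core" "b \<in> B"
  shows "proj (conj_by G b a) = proj (inv b)"
  using conj_B_cases_mod_core[OF assms(1)] core_memI_centralizing[OF assms(1)] assms by blast

text \<open>Both \<open>a\<close> and \<open>y\<close> invert \<open>B\<close> modulo the core, so
  their product centralizes it there.\<close>

lemma core_index_two:
  assumes "a \<in> A" "a \<notin> core" "y \<in> A" "y \<notin> core"
  shows "y \<otimes> a \<in> core"
proof (rule core_memI_centralizing)
  show "y \<otimes> a \<in> A" using assms A by (simp add: subgroup.m_closed)
  fix b assume b: "b \<in> B"
  have "proj (conj_by G b (y \<otimes> a)) = conj_by Q (proj (conj_by G b y)) (proj a)"
    using assms b by (simp add: proj.hom_conj_by flip: conj_by_conj_by)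
  also have "\<dots> = proj (conj_by G (inv b) a)"
    using conj_B_mod_core[OF assms(3,4) b] assms b by (simp add: proj.hom_conj_by)
  also have "\<dots> = proj b"
    using conj_B_mod_core[OF assms(1,2), of "inv b"] b B by (simp add: subgroup.m_inv_closed)
  finally show "proj (conj_by G b (y \<otimes> a)) = proj b" .
qed

section \<open>Decomposing G by the core, \<open>B\<close> and one element outside the core\<close>

lemma A_inter_B: "A \<inter> B = {\<one>}"
proof
  show "A \<inter> B \<subseteq> {\<one>}" using A_periodic B_torsion_free by blast
  show "{\<one>} \<subseteq> A \<inter> B" using A B by (simp add: subgroup.one_closed)
qed

text \<open>For \<open>y\<close> outside the core, \<open>y \<otimes> a\<close> lies in the core, so
  \<open>y\<close> is a core element times \<open>inv a\<close>.\<close>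

lemma A_eq_core_mult:
  assumes a: "a \<in> A" "a \<notin> core"
  shows "A = core <#> generate G {a}"
proof
  have gen: "subgroup (generate G {a}) G" using a by (intro generate_is_subgroup) simp
  have aa: "a \<in> generate G {a}" by (rule generate.incl) simp
  show "A \<subseteq> core <#> generate G {a}"
  proof
    fix y assume y: "y \<in> A"
    have "\<exists>k\<in>core. \<exists>u\<in>generate G {a}. y = k \<otimes> u"
    proof (cases "y \<in> core")
      case True
      then show ?thesis using subgroup.one_closed[OF gen] r_one[of y] y by force
    next
      case False
      have "y = (y \<otimes> a) \<otimes> inv a" using y a by (simp add: m_assoc)
      then show ?thesis using core_index_two[OF a y False] subgroup.m_inv_closed[OF gen aa] by blast
    qed
    then show "y \<in> core <#> generate G {a}" by (auto simp: set_mult_def)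
  qed
  have "generate G {a} \<subseteq> A" using a A by (intro generate_subgroup_incl) auto
  then show "core <#> generate G {a} \<subseteq> A"
    using core_subset A by (auto simp: set_mult_def intro!: subgroup.m_closed)
qed

lemma carrier_eq_core_B_mult:
  assumes a: "a \<in> A" "a \<notin> core"
  shows "carrier G = (core <#> B) <#> generate G {a}"
proof
  have "generate G {a} \<subseteq> carrier G" using a by (intro generate_incl) simp
  then show "(core <#> B) <#> generate G {a} \<subseteq> carrier G" by (auto simp: set_mult_def)
  show "carrier G \<subseteq> (core <#> B) <#> generate G {a}"
  proof
    fix g assume "g \<in> carrier G"
    then obtain b y where gby: "b \<in> B" "y \<in> A" "g = b \<otimes> y" using factor' by blast
    have "y \<in> core <#> generate G {a}" using gby(2) A_eq_core_mult[OF a] by blast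
    then obtain k u where ku: "k \<in> core" "u \<in> generate G {a}" "y = k \<otimes> u"
      by (auto simp: set_mult_def)
    have u: "u \<in> carrier G" using ku(2) \<open>generate G {a} \<subseteq> carrier G\<close> by blast
    \<comment> \<open>Chosen so that \<open>b \<otimes> k = k' \<otimes> b\<close>, which brings the
      core factor to the front.\<close>
    define k' where "k' = conj_by G k (inv b)"
    have "k' \<in> core" using core_normal gby ku by (simp add: k'_def normal_conj_by_iff)
    moreover have "g = (k' \<otimes> b) \<otimes> u" using gby ku u by (simp add: k'_def conj_by_def m_assoc)
    ultimately show "g \<in> (core <#> B) <#> generate G {a}"
      using gby(1) ku(2) by (auto simp: set_mult_def)
  qed
qed

lemma core_B_semidirect: "is_semidirect G (core <#> B) core B"
  unfolding is_semidirect_def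
proof (intro conjI refl B)
  show sub: "subgroup (core <#> B) G" using core_normal B by (rule mult_norm_subgroup)
  have "core \<subseteq> core <#> B"
  proof
    fix x assume "x \<in> core"
    then have "x = x \<otimes> \<one>" "\<one> \<in> B" using B by (simp_all add: subgroup.one_closed)
    with \<open>x \<in> core\<close> show "x \<in> core <#> B" unfolding set_mult_def by blast
  qed
  then show "core \<lhd> G\<lparr>carrier := core <#> B\<rparr>"
    by (rule normal_restrict_supergroup[OF sub core_normal])
  show "core \<inter> B = {\<one>}"
    using A_inter_B core_subset subgroup.one_closed[OF core.subgroup_axioms] by blast
qed

text \<open>The map is forced by the required formula for the conjugate of \<open>b\<close> by
  \<open>a\<close>; its values lie in the core because \<open>a\<close> inverts \<open>B\<close>
  modulo the core. Expanding the value at \<open>c \<otimes> b\<close> gives the derivation rule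
  with \<open>inv b\<close> in place of \<open>b\<close>, and these two act alike on the
  core.\<close>

lemma inverting_derivation:
  assumes a: "a \<in> A" "a \<notin> core"
  shows "derivation G B core (\<lambda>b. b \<otimes> conj_by G b a)"
proof -
  let ?\<phi> = "\<lambda>b. b \<otimes> conj_by G b a"
  note [simp] = a(1)
  have phi: "?\<phi> b \<in> core" if b: "b \<in> B" for b
  proof -
    have "proj (?\<phi> b) = proj b \<otimes>\<^bsub>Q\<^esub> proj (inv b)"
      using conj_B_mod_core[OF a b] b by (simp del: mult_FactGroup)
    also have "\<dots> = proj (b \<otimes> inv b)" using b by (intro proj.hom_mult[symmetric]) simp_all
    also have "\<dots> = proj \<one>" using b by simp
    finally obtain k where "k \<in> core" "?\<phi> b = k \<otimes> \<one>"
      using core.r_coset_eq_iff[of "?\<phi> b" \<one>] b by auto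
    then show ?thesis by simp
  qed
  have A_conj: "conj_by G x y = x" if "x \<in> A" "y \<in> A" for x y
    using A_comm[OF that] that by (simp add: conj_by_eq_iff)
  have conj_core: "conj_by G x g \<in> A" if "x \<in> core" "g \<in> carrier G" for x g
    using that unfolding core_def by blast
  \<comment> \<open>Elements of \<open>A\<close> act trivially on the core and on its conjugates,
    and \<open>b \<otimes> a = a \<otimes> inv b \<otimes> ?\<phi> b\<close> with both
    \<open>a\<close> and \<open>?\<phi> b\<close> in \<open>A\<close>.\<close>
  have inv_conj: "conj_by G x (inv b) = conj_by G x b" if x: "x \<in> core" and b: "b \<in> B" for x b
  proof -
    have xA: "x \<in> A" using x core_subset by blast
    have pA: "?\<phi> b \<in> A" using phi[OF b] core_subset by blast
    have "conj_by G x b = conj_by G (conj_by G x b) a"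
      using x b by (simp add: A_conj conj_core)
    also have "\<dots> = conj_by G x (a \<otimes> (inv b \<otimes> ?\<phi> b))"
      using x b by (simp add: conj_by_conj_by conj_by_def m_assoc inv_mult_group)
    also have "\<dots> = conj_by G (conj_by G (conj_by G x a) (inv b)) (?\<phi> b)"
      using x b by (simp add: conj_by_conj_by m_assoc)
    also have "\<dots> = conj_by G (conj_by G x (inv b)) (?\<phi> b)" using A_conj[OF xA a(1)] by simp
    also have "\<dots> = conj_by G x (inv b)" using A_conj[OF _ pA] conj_core[OF x] b by simp
    finally show ?thesis ..
  qed
  have "?\<phi> (b \<otimes> c) = ?\<phi> b \<otimes> conj_by G (?\<phi> c) b" if b: "b \<in> B" and c: "c \<in> B" for b c
  proof -
    have bc: "b \<otimes> c \<in> B" using b c B by (simp add: subgroup.m_closed)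
    \<comment> \<open>Swapping the factors under the conjugation places \<open>c\<close> next to its
      conjugate, so that the value at \<open>c\<close> appears as a block.\<close>
    have "?\<phi> (b \<otimes> c) = b \<otimes> c \<otimes> conj_by G (c \<otimes> b) a" by (simp only: B_comm[OF b c])
    also have "\<dots> = conj_by G (?\<phi> c) (inv b) \<otimes> ?\<phi> b"
      using b c by (simp add: conj_by_mult) (simp add: conj_by_def m_assoc)
    also have "\<dots> = conj_by G (?\<phi> c) b \<otimes> ?\<phi> b" using inv_conj[OF phi[OF c] b] by simp
    also have "\<dots> = ?\<phi> b \<otimes> conj_by G (?\<phi> c) b"
      using conj_core[OF phi[OF c]] phi[OF b] core_subset b by (intro A_comm) auto
    finally show ?thesis .
  qed
  then show ?thesis using phi by (simp add: derivation_def)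
qed

end

theorem theorem4p3:
  fixes G :: "('a, 'b) monoid_scheme" (structure) and A B :: "'a set"
  assumes "group G"
    and "subgroup A G" and "subgroup B G"
    and "carrier G = A <#> B"
    and "locally_cyclic (G\<lparr>carrier := A\<rparr>)" and "locally_cyclic (G\<lparr>carrier := B\<rparr>)"
    and "periodic (G\<lparr>carrier := A\<rparr>)"
    and "B \<noteq> {\<one>}" and "torsion_free (G\<lparr>carrier := B\<rparr>)"
  shows "(A \<lhd> G \<and> is_semidirect G (carrier G) A B) \<or>
    (\<exists>A1 a \<phi>. subgroup A1 G \<and> A1 \<subseteq> A \<and> a \<in> A \<and> a [^] (2::nat) \<in> A1 \<and>
      A = A1 <#> generate G {a} \<and>
      A1 \<lhd> G \<and>
      is_semidirect G (A1 <#> B) A1 B \<and>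
      carrier G = (A1 <#> B) <#> generate G {a} \<and>
      derivation G B A1 \<phi> \<and>
      (\<forall>b\<in>B. conj_by G b a = inv b \<otimes> \<phi> b))"
proof -
  interpret group G by fact
  interpret periodic_by_rank_one G A B
  proof (intro periodic_by_rank_one.intro abelian_factorization.intro
      abelian_factorization_axioms.intro periodic_by_rank_one_axioms.intro)
    show "\<exists>a\<in>A. \<exists>b\<in>B. g = a \<otimes> b" if "g \<in> carrier G" for g
      using that assms(4) by (auto simp: set_mult_def)
    show "\<exists>n::nat. n > 0 \<and> a [^] n = \<one>" if "a \<in> A" for a
      using assms(7) that by (auto simp: periodic_def simp flip: nat_pow_consistent)
    show "b = \<one>" if "b \<in> B" "n > 0" "b [^] n = \<one>" for b and n :: nat
      using assms(9) that by (auto simp: torsion_free_def simp flip: nat_pow_consistent)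
    show "x \<otimes> y = y \<otimes> x" if "x \<in> A" "y \<in> A" for x y
      using assms(2,5) that by (rule locally_cyclic_commute)
    show "x \<otimes> y = y \<otimes> x" if "x \<in> B" "y \<in> B" for x y
      using assms(3,6) that by (rule locally_cyclic_commute)
    show "\<exists>z\<in>B. \<exists>(i::int) (j::int). b = z [^] i \<and> c = z [^] j" if "b \<in> B" "c \<in> B" for b c
      using assms(3,6) that by (rule locally_cyclic_common_root)
  qed fact+
  show ?thesis
  proof (cases "A \<subseteq> core")
    case True
    then have "A = core" using core_subset by blast
    then have normal: "A \<lhd> G" using core_normal by simp
    moreover have "is_semidirect G (carrier G) A B"
      unfolding is_semidirect_def
    proof (intro conjI)
      show "A \<lhd> G\<lparr>carrier := carrier G\<rparr>" using normal by simp
    qed (fact subgroup_self B assms(4) A_inter_B)+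
    ultimately show ?thesis by blast
  next
    case False
    then obtain a where a: "a \<in> A" "a \<notin> core" by blast
    \<comment> \<open>The index-two argument with both elements equal to \<open>a\<close>.\<close>
    have "a [^] (2::nat) \<in> core" using core_index_two[OF a a] a by (simp add: numeral_2_eq_2)
    moreover have "\<forall>b\<in>B. conj_by G b a = inv b \<otimes> (b \<otimes> conj_by G b a)" using a by simp
    ultimately show ?thesis
      using core.subgroup_axioms core_subset a(1) A_eq_core_mult[OF a] core_normal core_B_semidirect
        carrier_eq_core_B_mult[OF a] inverting_derivation[OF a]
      by (intro disjI2 exI[of _ core] exI[of _ a] exI[of _ "\<lambda>b. b \<otimes> conj_by G b a"] conjI)
  qed
qed

end
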